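(* Let $X$ be a Sturmian sequence in $\{0,1\}^{\mathbb{N}}$ (respectively, a Sturmian bi-sequence in $\{0,1\}^{\mathbb{Z}}$) of density $\alpha\notin\mathbb{Q}$. Then the orbit closure $\overline{O^+(X)}$ contains exactly one sequence (respectively, exactly one bi-sequence) which is $\alpha$-heavy.
   Context: For a sequence or bi-sequence $X=(x_i)$ and $i\le j$, $X_{i,j}=x_i\ldots x_{j-1}$. The weight of a word $A=a_0\ldots a_{n-1}$ is $w(A)=\sum a_i$ and its average weight is $\overline{w}(A)=w(A)/n$. A finite word is a factor of $X$ if it occurs as a block of consecutive entries of $X$. A binary sequence or bi-sequence is Sturmian if any two of its factors of the same length have weights differing by at most one; its density $d(X)=\lim_{n\to\infty}\overline{w}(X_{0,n})$ then exists. A sequence or bi-sequence $Y$ is $\alpha$-heavy if $\overline{w}(Y_{0,i})\ge\alpha$ for all integers $i\ge 1$. The shift is $\sigma(X)_n=X_{n+1}$, and $\overline{O^+(X)}$ is the closure, in the product topology on $\{0,1\}^{\mathbb{N}}$ (respectively $\{0,1\}^{\mathbb{Z}}$), of $\{\sigma^nX : n\ge 0\}$. *)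

theory Defs
  imports "HOL-Analysis.Analysis"
begin

text \<open>
  Sequences and bi-sequences are functions \<open>'i \<Rightarrow> nat\<close>; only the index types \<open>'i = nat\<close>
  (sequences) and \<open>'i = int\<close> (bi-sequences) are intended.
\<close>

text \<open>\<open>block X i n\<close> is the word \<open>X\<^bsub>i,i+n\<^esub> = x\<^sub>i \<dots> x\<^bsub>i+n-1\<^esub>\<close>, parametrised by its length \<open>n\<close>
  so that the same definition serves both index types.\<close>

definition block :: "('i::semiring_1 \<Rightarrow> nat) \<Rightarrow> 'i \<Rightarrow> nat \<Rightarrow> nat list" where
  "block X i n = map (\<lambda>k. X (i + of_nat k)) [0..<n]"

definition weight :: "nat list \<Rightarrow> nat" where
  "weight A = sum_list A"

definition avg_weight :: "nat list \<Rightarrow> real" where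
  "avg_weight A = real (weight A) / real (length A)"

definition factors :: "('i::semiring_1 \<Rightarrow> nat) \<Rightarrow> nat list set" where
  "factors X = {block X i n | i n. True}"

definition binary :: "('i \<Rightarrow> nat) \<Rightarrow> bool" where
  "binary X \<longleftrightarrow> (\<forall>i. X i \<in> {0, 1})"

definition sturmian :: "('i::semiring_1 \<Rightarrow> nat) \<Rightarrow> bool" where
  "sturmian X \<longleftrightarrow> binary X \<and>
     (\<forall>A \<in> factors X. \<forall>B \<in> factors X.
        length A = length B \<longrightarrow> \<bar>int (weight A) - int (weight B)\<bar> \<le> 1)"

text \<open>The limit exists whenever \<open>X\<close> is Sturmian; for other \<open>X\<close> the value may be unspecified.\<close>

definition seq_density :: "('i::semiring_1 \<Rightarrow> nat) \<Rightarrow> real" where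
  "seq_density X = lim (\<lambda>n. avg_weight (block X 0 n))"

definition heavy :: "real \<Rightarrow> ('i::semiring_1 \<Rightarrow> nat) \<Rightarrow> bool" where
  "heavy \<alpha> Y \<longleftrightarrow> (\<forall>n\<ge>1. avg_weight (block Y 0 n) \<ge> \<alpha>)"

definition seq_shift :: "('i::semiring_1 \<Rightarrow> nat) \<Rightarrow> 'i \<Rightarrow> nat" where
  "seq_shift X = (\<lambda>n. X (n + 1))"

text \<open>The topological space has carrier \<open>{0,1}\<^sup>\<nat>\<close>, respectively \<open>{0,1}\<^sup>\<int>\<close>, so every member of the
  orbit closure is binary. Only forward iterates of the shift are taken, also for bi-sequences.\<close>

definition binary_space :: "('i \<Rightarrow> nat) topology" where
  "binary_space = product_topology (\<lambda>_. discrete_topology {0, 1}) UNIV"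

definition orbit_closure :: "('i::semiring_1 \<Rightarrow> nat) \<Rightarrow> ('i \<Rightarrow> nat) set" where
  "orbit_closure X = binary_space closure_of {(seq_shift ^^ n) X | n. True}"

end

theory Submission
  imports Defs
begin

text \<open>
  Balance forces every block of length \<open>n\<close> to have weight at distance less than 1 from \<open>n\<alpha>\<close>, in
  \<open>X\<close> and hence in every element of its orbit closure. Heaviness therefore leaves only the value
  \<open>\<lceil>n\<alpha>\<rceil>\<close> for the prefix of length \<open>n\<close>, which determines a heavy point to the right of 0. To the
  left of 0 the block ending at 0 must have weight \<open>\<lfloor>n\<alpha>\<rfloor>\<close>: if its weight exceeded \<open>n\<alpha>\<close> by some
  \<open>\<delta> > 0\<close>, appending a prefix of length \<open>m\<close> with the fractional part of \<open>m\<alpha>\<close> below \<open>\<delta>\<close> would give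
  a block of weight more than \<open>(n + m)\<alpha> + 1\<close>. A heavy point exists by compactness: shift \<open>X\<close> to
  positions at which the discrepancy of the prefix approaches its infimum.
\<close>

section \<open>Weights of blocks\<close>

lemma length_block [simp]: "length (block X i n) = n"
  by (simp add: block_def)

lemma block_in_factors: "block X i n \<in> factors X"
  by (auto simp: factors_def)

lemma weight_block: "weight (block X i n) = (\<Sum>k<n. X (i + of_nat k))"
  by (simp add: weight_def block_def sum_list_sum_nth atLeast0LessThan)

lemma weight_block_Suc: "weight (block X i (Suc n)) = weight (block X i n) + X (i + of_nat n)"
  by (simp add: weight_block)

lemma weight_block_add:
  "weight (block X i (m + n)) = weight (block X i m) + weight (block X (i + of_nat m) n)"
  by (induction n) (simp_all add: weight_block add.assoc)

lemma funpow_seq_shift: "(seq_shift ^^ n) X = (\<lambda>i. X (i + of_nat n))"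
  by (induction n) (auto simp: seq_shift_def algebra_simps)

section \<open>Discrepancy of balanced words\<close>

lemma sturmian_weight_diff_le:
  assumes "sturmian X"
  shows "\<bar>real (weight (block X i n)) - real (weight (block X j n))\<bar> \<le> 1"
proof -
  have "\<bar>int (weight (block X i n)) - int (weight (block X j n))\<bar> \<le> 1"
    using assms block_in_factors[of X] by (auto simp: sturmian_def)
  then show ?thesis by linarith
qed

text \<open>The long block splits into m consecutive blocks of length n, and balance compares each
  of them with \<open>block X i n\<close> at a cost of at most 1.\<close>

lemma sturmian_weight_multiple:
  assumes "sturmian X"
  shows "\<bar>real (weight (block X j (m * n))) - m * real (weight (block X i n))\<bar> \<le> m"
proof (induction m)
  case 0
  show ?case by (simp add: weight_block)
next
  case (Suc m)
  have "weight (block X j (Suc m * n)) =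
      weight (block X j (m * n)) + weight (block X (j + of_nat (m * n)) n)"
    using weight_block_add[of X j "m * n" n] by (simp add: add.commute)
  moreover have "real (Suc m) * real (weight (block X i n)) =
      m * real (weight (block X i n)) + real (weight (block X i n))"
    by (simp add: algebra_simps)
  ultimately show ?case
    using Suc sturmian_weight_diff_le[OF assms, of "j + of_nat (m * n)" n i] by linarith
qed

lemma sturmian_avg_weight_multiple:
  assumes "sturmian X" "m > 0" "n > 0"
  shows "\<bar>avg_weight (block X j (m * n)) - avg_weight (block X i n)\<bar> \<le> 1 / n"
proof -
  have "avg_weight (block X j (m * n)) - avg_weight (block X i n) =
      (real (weight (block X j (m * n))) - m * real (weight (block X i n))) / (m * n)"
    using assms by (simp add: avg_weight_def field_simps)
  moreover have "\<dots> \<le> m / (m * n)" "\<dots> \<ge> - m / (m * n)"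
    using sturmian_weight_multiple[OF assms(1), of j m n i]
    by (intro divide_right_mono; simp; linarith)+
  ultimately show ?thesis using assms by (simp add: abs_le_iff)
qed

text \<open>The prefix averages form a Cauchy sequence: those of lengths m and n are both compared
  with the one of length m * n, at a cost of 1/m and 1/n.\<close>

lemma sturmian_avg_weight_converges:
  assumes "sturmian X"
  shows "(\<lambda>n. avg_weight (block X 0 n)) \<longlonglongrightarrow> seq_density X"
proof -
  let ?a = "\<lambda>n. avg_weight (block X 0 n)"
  have "Cauchy ?a"
  proof (rule metric_CauchyI)
    fix e :: real assume "e > 0"
    obtain N :: nat where N: "N > 0" "2 / e < N"
      using reals_Archimedean2[of "2 / e"] \<open>e > 0\<close>
      by (metis divide_pos_pos gr0I less_asym of_nat_0 zero_less_numeral)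
    have "dist (?a m) (?a n) < e" if "m \<ge> N" "n \<ge> N" for m n
    proof -
      have pos: "m > 0" "n > 0" using that N by auto
      have "1 / m \<le> 1 / N" "1 / n \<le> 1 / N"
        using that N pos by (simp_all add: frac_le)
      moreover have "1 / N < e / 2" using N \<open>e > 0\<close> by (simp add: field_simps)
      moreover have "\<bar>?a (n * m) - ?a m\<bar> \<le> 1 / m" "\<bar>?a (m * n) - ?a n\<bar> \<le> 1 / n"
        using sturmian_avg_weight_multiple[OF assms] pos by blast+
      ultimately show ?thesis
        by (simp add: dist_real_def mult.commute[of n m])
    qed
    then show "\<exists>N. \<forall>m\<ge>N. \<forall>n\<ge>N. dist (?a m) (?a n) < e" by blast
  qed
  then show ?thesis
    by (simp add: seq_density_def Cauchy_convergent convergent_LIMSEQ_iff[symmetric])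
qed

text \<open>In \<open>sturmian_avg_weight_multiple\<close> the bound 1/n does not depend on the
  multiple, so it survives when the long average tends to the density; then multiply by n.\<close>

lemma sturmian_discrepancy_le:
  assumes "sturmian X"
  shows "\<bar>real (weight (block X i n)) - n * seq_density X\<bar> \<le> 1"
proof (cases "n = 0")
  case True
  then show ?thesis by (simp add: weight_block)
next
  case False
  \<comment> \<open>\<open>Suc m\<close> keeps the multiple positive, as the comparison of averages
    requires.\<close>
  then have "strict_mono (\<lambda>m. Suc m * n)" by (simp add: strict_mono_Suc_iff)
  then have "(\<lambda>m. avg_weight (block X 0 (Suc m * n))) \<longlonglongrightarrow> seq_density X"
    using LIMSEQ_subseq_LIMSEQ[OF sturmian_avg_weight_converges[OF assms]] by (simp add: o_def)
  then have "(\<lambda>m. \<bar>avg_weight (block X 0 (Suc m * n)) - avg_weight (block X i n)\<bar>)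
      \<longlonglongrightarrow> \<bar>seq_density X - avg_weight (block X i n)\<bar>"
    by (intro tendsto_intros)
  then have "\<bar>seq_density X - avg_weight (block X i n)\<bar> \<le> 1 / n"
    by (rule LIMSEQ_le_const2) (use sturmian_avg_weight_multiple[OF assms] False in blast)
  then have "n * \<bar>seq_density X - avg_weight (block X i n)\<bar> \<le> 1"
    using False by (simp add: field_simps)
  moreover have "n * \<bar>seq_density X - avg_weight (block X i n)\<bar> =
      \<bar>n * (seq_density X - avg_weight (block X i n))\<bar>"
    by (simp add: abs_mult)
  ultimately show ?thesis
    using False by (simp add: avg_weight_def algebra_simps abs_minus_commute)
qed

text \<open>Equality would exhibit the density as a quotient of an integer by n; for n = 0 the
  discrepancy is 0.\<close>

lemma sturmian_discrepancy_less:
  assumes "sturmian X" "seq_density X \<notin> \<rat>"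
  shows "\<bar>real (weight (block X i n)) - n * seq_density X\<bar> < 1"
proof -
  let ?w = "real (weight (block X i n))"
  have "\<bar>?w - n * seq_density X\<bar> \<noteq> 1"
  proof
    assume *: "\<bar>?w - n * seq_density X\<bar> = 1"
    then have "n \<noteq> 0" by (cases "n = 0") (auto simp: weight_block)
    from * have "n * seq_density X = ?w - 1 \<or> n * seq_density X = ?w + 1" by linarith
    then have "seq_density X = (?w - 1) / n \<or> seq_density X = (?w + 1) / n"
      using \<open>n \<noteq> 0\<close> by (simp add: field_simps)
    moreover have "(?w - 1) / n \<in> \<rat>" "(?w + 1) / n \<in> \<rat>" by simp_all
    ultimately show False using assms(2) by auto
  qed
  with sturmian_discrepancy_le[OF assms(1), of i n] show ?thesis by linarith
qed

section \<open>Orbit closures\<close>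

lemma topspace_binary_space: "topspace binary_space = {Y. binary Y}"
  by (simp add: binary_space_def binary_def PiE_def Pi_def)

lemma compact_space_binary_space: "compact_space binary_space"
  by (simp add: binary_space_def compact_space_product_topology compact_space_discrete_topology)

lemma binary_closure_of_agrees:
  assumes Y: "Y \<in> binary_space closure_of S" and "finite F"
  obtains Z where "Z \<in> S" "\<And>i. i \<in> F \<Longrightarrow> Z i = Y i"
proof -
  have bin: "Y i \<in> {0, 1}" for i
    using Y closure_of_subset_topspace[of binary_space S]
    by (auto simp: topspace_binary_space binary_def)
  \<comment> \<open>The cylinder of sequences agreeing with Y on F; it is open because it restricts
    only finitely many coordinates.\<close>
  define U where "U = (\<lambda>i. if i \<in> F then {Y i} else {0, 1})"
  have "{i. U i \<noteq> {0, 1}} \<subseteq> F" by (auto simp: U_def)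
  with \<open>finite F\<close> have "finite {i. U i \<noteq> {0, 1}}" by (rule finite_subset[rotated])
  then have "openin binary_space (PiE UNIV U)"
    unfolding binary_space_def
    by (intro product_topology_basis) (use bin in \<open>auto simp: U_def\<close>)
  moreover have "Y \<in> PiE UNIV U" using bin by (auto simp: U_def)
  ultimately obtain Z where "Z \<in> S" and Z: "Z \<in> PiE UNIV U"
    using Y unfolding in_closure_of by blast
  moreover have "Z i = Y i" if "i \<in> F" for i
    using Z that by (auto simp: U_def PiE_iff dest: spec[of _ i])
  ultimately show thesis using that by blast
qed

text \<open>The predicate P allows use both for the full orbit and, in \<open>heavy_exists\<close>,
  for shifts by selected positions only.\<close>

lemma closure_of_shifts_block:
  assumes "Y \<in> binary_space closure_of {(seq_shift ^^ p) X | p. P p}"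
  obtains p where "P p" "weight (block Y i n) = weight (block X (i + of_nat p) n)"
proof -
  obtain Z where "Z \<in> {(seq_shift ^^ p) X | p. P p}"
    and Z: "\<And>j. j \<in> (\<lambda>k. i + of_nat k) ` {..<n} \<Longrightarrow> Z j = Y j"
    using binary_closure_of_agrees[OF assms, of "(\<lambda>k. i + of_nat k) ` {..<n}"] by blast
  then obtain p where "P p" and p: "Z = (\<lambda>i. X (i + of_nat p))"
    by (auto simp: funpow_seq_shift)
  have "weight (block Y i n) = (\<Sum>k<n. Z (i + of_nat k))"
    unfolding weight_block by (intro sum.cong) (use Z in auto)
  then have "weight (block Y i n) = weight (block X (i + of_nat p) n)"
    by (simp add: p weight_block add_ac)
  with \<open>P p\<close> show thesis by (rule that)
qed

lemma orbit_closure_discrepancy_less: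
  assumes "sturmian X" "seq_density X \<notin> \<rat>" "Y \<in> orbit_closure X"
  shows "\<bar>real (weight (block Y i n)) - n * seq_density X\<bar> < 1"
proof -
  obtain p where "weight (block Y i n) = weight (block X (i + of_nat p) n)"
    using closure_of_shifts_block[of Y X "\<lambda>_. True"] assms(3) unfolding orbit_closure_def by blast
  with sturmian_discrepancy_less[OF assms(1,2)] show ?thesis by simp
qed

section \<open>Heavy points\<close>

text \<open>Clearing the denominator admits n = 0, where both sides vanish, and so removes the side
  condition.\<close>

lemma heavy_iff: "heavy \<alpha> Y \<longleftrightarrow> (\<forall>n. real n * \<alpha> \<le> real (weight (block Y 0 n)))"
proof -
  have "avg_weight (block Y 0 n) \<ge> \<alpha> \<longleftrightarrow> real n * \<alpha> \<le> real (weight (block Y 0 n))" if "n \<ge> 1" for n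
    using that by (simp add: avg_weight_def field_simps)
  moreover have "real 0 * \<alpha> \<le> real (weight (block Y 0 0))" by simp
  ultimately show ?thesis
    unfolding heavy_def by (metis One_nat_def Suc_leI gr0I)
qed

lemma heavy_exists:
  assumes "sturmian X"
  shows "\<exists>Y \<in> orbit_closure X. heavy (seq_density X) Y"
proof -
  \<comment> \<open>The prefix discrepancy, whose increment from p to p + n is the discrepancy of
    the block of length n at p. It is bounded below by balance.\<close>
  define D where "D = (\<lambda>n. weight (block X 0 n) - n * seq_density X)"
  define m where "m = (INF n. D n)"
  have bdd: "bdd_below (range D)"
  proof (rule bdd_belowI2)
    show "- 1 \<le> D n" for n
      using sturmian_discrepancy_le[OF assms, of 0 n] by (simp add: D_def)
  qed
  \<comment> \<open>The infimum may not be attained, so positions within 1/(k+1) of it are taken;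
    the closures \<open>C k\<close> of the corresponding shifts are nested, closed and
    nonempty.\<close>
  define P where "P = (\<lambda>k p. D p < m + 1 / Suc k)"
  define C where "C = (\<lambda>k. binary_space closure_of {(seq_shift ^^ p) X | p. P k p})"
  have "(\<Inter>k. C k) \<noteq> {}"
  proof (rule compact_space_imp_nest[OF compact_space_binary_space])
    show "closedin binary_space (C k)" for k by (simp add: C_def)
    show "C k \<noteq> {}" for k
    proof -
      have "m < m + 1 / Suc k" by simp
      then obtain p where p: "P k p"
        unfolding m_def P_def using bdd by (subst (asm) cINF_less_iff) auto
      have "(seq_shift ^^ p) X \<in> topspace binary_space"
        using assms by (simp add: funpow_seq_shift topspace_binary_space sturmian_def binary_def)
      with p have "(seq_shift ^^ p) X \<in> C k"
        unfolding C_def in_closure_of by blast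
      then show ?thesis by blast
    qed
    show "decseq C"
      unfolding decseq_Suc_iff C_def
    proof (intro allI closure_of_mono)
      fix k
      have "1 / real (Suc (Suc k)) \<le> 1 / Suc k" by (intro divide_left_mono) auto
      then have "P (Suc k) p \<Longrightarrow> P k p" for p unfolding P_def by linarith
      then show "{(seq_shift ^^ p) X | p. P (Suc k) p} \<subseteq> {(seq_shift ^^ p) X | p. P k p}" by blast
    qed
  qed
  then obtain Y where Y: "\<And>k. Y \<in> C k" by blast
  have "Y \<in> orbit_closure X"
  proof -
    have "C 0 \<subseteq> orbit_closure X"
      unfolding C_def orbit_closure_def by (rule closure_of_mono) blast
    with Y show ?thesis by blast
  qed
  moreover have "n * seq_density X \<le> weight (block Y 0 n)" for n
  proof (rule field_le_epsilon)
    fix e :: real assume "e > 0"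
    then obtain k where k: "1 / Suc k < e"
      using reals_Archimedean[of e] by (auto simp: inverse_eq_divide)
    obtain p where p: "P k p" "weight (block Y 0 n) = weight (block X (0 + of_nat p) n)"
      using closure_of_shifts_block[of Y X "P k" 0 n] Y unfolding C_def by blast
    \<comment> \<open>From a nearly minimal position D can drop by less than 1/(k+1), hence by less
      than e.\<close>
    have "m \<le> D (p + n)"
      unfolding m_def by (rule cINF_lower[OF bdd]) simp
    moreover have "D (p + n) = D p + (weight (block Y 0 n) - n * seq_density X)"
      using weight_block_add[of X 0 p n] p(2) by (simp add: D_def distrib_right)
    ultimately show "n * seq_density X \<le> weight (block Y 0 n) + e"
      using p(1) k unfolding P_def by linarith
  qed
  ultimately show ?thesis by (auto simp: heavy_iff)
qed

text \<open>The weight is an integer in the half-open interval from n\<alpha> (included) to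
  n\<alpha> + 1, with \<alpha> the density.\<close>

lemma heavy_prefix_weight:
  assumes "sturmian X" "seq_density X \<notin> \<rat>" "Y \<in> orbit_closure X" "heavy (seq_density X) Y"
  shows "int (weight (block Y 0 n)) = \<lceil>n * seq_density X\<rceil>"
  using orbit_closure_discrepancy_less[OF assms(1-3), of 0 n] assms(4)
  unfolding heavy_iff by (intro ceiling_unique[symmetric]) (auto simp: abs_less_iff)

text \<open>An entry is the difference of two consecutive prefix weights, and these are
  prescribed.\<close>

lemma heavy_unique_of_nat:
  assumes "sturmian X" "seq_density X \<notin> \<rat>"
    and "Y \<in> orbit_closure X" "heavy (seq_density X) Y"
    and "Z \<in> orbit_closure X" "heavy (seq_density X) Z"
  shows "Y (of_nat n) = Z (of_nat n)"
proof -
  have "weight (block Y 0 k) = weight (block Z 0 k)" for k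
    using heavy_prefix_weight[OF assms(1,2)] assms(3-) by (metis of_nat_eq_iff)
  then show ?thesis
    using weight_block_Suc[of Y 0 n] weight_block_Suc[of Z 0 n] by simp
qed

lemma heavy_suffix_weight:
  fixes X :: "int \<Rightarrow> nat"
  assumes "sturmian X" "seq_density X \<notin> \<rat>" "Y \<in> orbit_closure X" "heavy (seq_density X) Y"
  shows "int (weight (block Y (- int n) n)) = \<lfloor>n * seq_density X\<rfloor>"
proof (rule floor_unique[symmetric])
  let ?\<alpha> = "seq_density X" and ?w = "real (weight (block Y (- int n) n))"
  note less = orbit_closure_discrepancy_less[OF assms(1-3)]
  show "n * ?\<alpha> < of_int (int (weight (block Y (- int n) n))) + 1"
    using less[of "- int n" n] by simp
  have "?w \<le> n * ?\<alpha>"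
  proof (rule ccontr)
    assume "\<not> ?w \<le> n * ?\<alpha>"
    \<comment> \<open>Kronecker's theorem with target 0: the fractional part of m\<alpha> is smaller
      than the supposed excess.\<close>
    then obtain m where "\<bar>frac (real m * ?\<alpha>) - 0\<bar> < ?w - n * ?\<alpha>" "m > 0"
      using Kronecker_approx_1_explicit[OF assms(2), of 0 "?w - n * ?\<alpha>"] by auto
    then have frac: "frac (m * ?\<alpha>) < ?w - n * ?\<alpha>" by simp
    \<comment> \<open>Irrationality and m > 0 make the ceiling equal to the floor plus 1, so the
      prefix of length m has surplus 1 - \<open>frac (m * ?\<alpha>)\<close>.\<close>
    have "m * ?\<alpha> \<notin> \<int>"
    proof
      assume "m * ?\<alpha> \<in> \<int>"
      then have "m * ?\<alpha> / m \<in> \<rat>" using Ints_subset_Rats by (intro Rats_divide) auto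
      with \<open>m > 0\<close> assms(2) show False by simp
    qed
    then have "real_of_int \<lceil>m * ?\<alpha>\<rceil> = \<lfloor>m * ?\<alpha>\<rfloor> + 1"
      by (simp add: ceiling_altdef) (metis Ints_of_int)
    then have "real (weight (block Y 0 m)) = m * ?\<alpha> - frac (m * ?\<alpha>) + 1"
      using heavy_prefix_weight[OF assms, of m] by (simp add: frac_def)
    moreover have "real (weight (block Y (- int n) (n + m))) = ?w + weight (block Y 0 m)"
      by (simp add: weight_block_add)
    \<comment> \<open>The two surpluses add up to more than 1, which no block of Y allows.\<close>
    ultimately have "real (weight (block Y (- int n) (n + m))) > (n + m) * ?\<alpha> + 1"
      using frac by (simp add: algebra_simps)
    with less[of "- int n" "n + m"] show False by simp
  qed
  then show "of_int (int (weight (block Y (- int n) n))) \<le> n * ?\<alpha>" by simp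
qed

lemma heavy_unique_int:
  fixes X :: "int \<Rightarrow> nat"
  assumes "sturmian X" "seq_density X \<notin> \<rat>"
    and "Y \<in> orbit_closure X" "heavy (seq_density X) Y"
    and "Z \<in> orbit_closure X" "heavy (seq_density X) Z"
  shows "Y = Z"
proof
  fix i :: int
  have suffix: "weight (block Y (- int k) k) = weight (block Z (- int k) k)" for k
    using heavy_suffix_weight[OF assms(1,2)] assms(3-) by (metis of_nat_eq_iff)
  \<comment> \<open>Splitting off the first letter recovers the entries left of 0 from successive
    suffix weights.\<close>
  have first: "weight (block W (- int (Suc n)) (Suc n)) =
      W (- int (Suc n)) + weight (block W (- int n) n)" for W :: "int \<Rightarrow> nat" and n
    using weight_block_add[of W "- int (Suc n)" 1 n] by (simp add: weight_block)
  show "Y i = Z i"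
  proof (cases i rule: int_cases)
    case (nonneg n)
    then show ?thesis using heavy_unique_of_nat[OF assms, of n] by simp
  next
    case (neg n)
    then show ?thesis
      using first[of Y n] first[of Z n] suffix[of n] suffix[of "Suc n"] by simp
  qed
qed

theorem corollary6:
  fixes \<alpha> :: real
  assumes "\<alpha> \<notin> \<rat>"
  shows "(\<forall>X :: nat \<Rightarrow> nat. sturmian X \<and> seq_density X = \<alpha> \<longrightarrow>
            (\<exists>!Y. Y \<in> orbit_closure X \<and> heavy \<alpha> Y)) \<and>
         (\<forall>X :: int \<Rightarrow> nat. sturmian X \<and> seq_density X = \<alpha> \<longrightarrow>
            (\<exists>!Y. Y \<in> orbit_closure X \<and> heavy \<alpha> Y))"
proof (intro conjI allI impI; elim conjE)
  fix X :: "nat \<Rightarrow> nat"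
  assume X: "sturmian X" "seq_density X = \<alpha>"
  \<comment> \<open>For sequences every index is some \<open>of_nat n\<close>, so the prefix weights
    alone give uniqueness.\<close>
  have "Y = Z" if "Y \<in> orbit_closure X \<and> heavy \<alpha> Y" "Z \<in> orbit_closure X \<and> heavy \<alpha> Z" for Y Z
    using heavy_unique_of_nat[of X Y Z] X assms that by (intro ext) simp
  with heavy_exists[OF X(1)] X(2) show "\<exists>!Y. Y \<in> orbit_closure X \<and> heavy \<alpha> Y" by blast
next
  fix X :: "int \<Rightarrow> nat"
  assume X: "sturmian X" "seq_density X = \<alpha>"
  have "Y = Z" if "Y \<in> orbit_closure X \<and> heavy \<alpha> Y" "Z \<in> orbit_closure X \<and> heavy \<alpha> Z" for Y Z
    using heavy_unique_int[of X Y Z] X assms that by simp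
  with heavy_exists[OF X(1)] X(2) show "\<exists>!Y. Y \<in> orbit_closure X \<and> heavy \<alpha> Y" by blast
qed

end
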